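(* Let $n, r \geq 1$. Then: (i) $\mathcal{S}_{(r,n)}(x) = \binom{r+n}{r}^{-1} \sum_{k=0}^{n} \binom{r+n}{k} (-1)^{n-k} x^k$; (ii) $\mathcal{S}_{(r,n)}(-1) = (-1)^n \binom{r+n}{r}^{-1} \sum_{k=0}^{n} \binom{r+n}{k}$; (iii) $(-1)^n \mathcal{S}_{(r,n)}(-1) + (-1)^r \mathcal{S}_{(n,r)}(-1) = 2^{r+n} \binom{r+n}{r}^{-1} + 1$; (iv) at least one of $\mathcal{S}_{(r,n)}(-1)$, $\mathcal{S}_{(n,r)}(-1)$ is not in $\mathbb{Z}$; in particular $\mathcal{S}_{(n,n)}(-1), \mathcal{S}_{(n+1,n)}(-1), \mathcal{S}_{(n,n+1)}(-1) \notin \mathbb{Z}$.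
   Context: For integers $n, r \geq 0$, $\mathcal{S}_{(r,n)}(x) = \sum_{k=0}^{n} \binom{n}{k} (-1)^k x^{n-k} \binom{r+k}{r}^{-1} \in \mathbb{Q}[x]$. *)

theory Defs
  imports Complex_Main "HOL-Computational_Algebra.Polynomial"
begin

definition S_poly :: "nat \<Rightarrow> nat \<Rightarrow> rat poly" where
  "S_poly r n = (\<Sum>k=0..n. monom (of_nat (n choose k) * (-1) ^ k * inverse (of_nat ((r + k) choose r))) (n - k))"

end

theory Submission
  imports Defs "HOL-Computational_Algebra.Primes"
begin

text \<open>Comparing coefficients gives (i), and (ii) and (iii) follow by evaluation at \<open>-1\<close>. If both values
  in (iv) were integers, (iii) would make \<open>(r + n) choose r\<close> a power of two. A prime power dividing
  a binomial coefficient \<open>N choose k\<close> is at most \<open>N\<close>, because \<open>k * (N choose k)\<close> divides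
  \<open>lcm(1, \<dots>, N)\<close>; hence \<open>r = 1\<close> or \<open>n = 1\<close>, and one of the two sums in (ii) is \<open>1 + N\<close>,
  which \<open>N\<close> does not divide. The sums belonging to \<open>(n, n + 1)\<close> and \<open>(n + 1, n)\<close> differ by
  \<open>(2 * n + 1) choose n\<close>, so neither value can be an integer without the other.\<close>

section \<open>Prime powers dividing binomial coefficients\<close>

text \<open>Induction along the Leibniz harmonic triangle: its entries \<open>L n k = 1 / (k * (n choose k))\<close>
  satisfy \<open>L n 1 = 1 / n\<close> and \<open>L (n + 1) (k + 1) = L n k - L (n + 1) k\<close>.\<close>

lemma leibniz_triangle_Ints:
  fixes M :: nat
  assumes "\<And>j. 1 \<le> j \<Longrightarrow> j \<le> n \<Longrightarrow> j dvd M" and "1 \<le> k" and "k \<le> n"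
  shows "(of_nat M :: rat) / of_nat (k * (n choose k)) \<in> \<int>"
  using assms(2,3,1)
proof (induction k arbitrary: n rule: dec_induct)
  case base
  then obtain c where "M = n * c"
    by (metis dvdE order.refl)
  then show ?case
    using base by simp
next
  case (step k)
  then obtain m where n: "n = Suc m"
    by (cases n) auto
  define a where "a = m choose k"
  define c where "c = n choose k"
  have km: "1 \<le> k" "k \<le> m" and pos: "a > 0" "c > 0"
    using step.hyps step.prems(1) by (auto simp: a_def c_def n)
  \<comment> \<open>Absorption and Pascal's rule eliminate \<open>m choose (k - 1)\<close>; the
    resulting relation \<open>rel\<close> is the triangle recurrence cleared of
    denominators.\<close>
  have "k * c = Suc m * (m choose (k - 1))"
    using km Suc_times_binomial[of "k - 1" m] by (simp add: c_def n)
  moreover have "c = (m choose (k - 1)) + a"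
    using km by (simp add: a_def c_def n binomial_eq_0 choose_reduce_nat)
  ultimately have "Suc m * a + k * c = Suc m * c"
    by (simp add: algebra_simps)
  then have rel: "(of_nat (Suc m) * of_nat a + of_nat k * of_nat c :: rat) = of_nat (Suc m) * of_nat c"
    by (metis of_nat_add of_nat_mult)
  have "Suc k * (n choose Suc k) = Suc m * a"
    unfolding n a_def by (rule Suc_times_binomial)
  then have "(of_nat M :: rat) / of_nat (Suc k * (n choose Suc k)) =
      of_nat M / (of_nat (Suc m) * of_nat a)"
    by (metis of_nat_mult)
  also have "\<dots> = of_nat M / of_nat (k * a) - of_nat M / of_nat (k * c)"
  proof -
    have "x / (s * u) = x / (t * u) - x / (t * v)"
      if "s * u + t * v = s * v" "s \<noteq> 0" "t \<noteq> 0" "u \<noteq> 0" "v \<noteq> 0" for x s t u v :: rat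
    proof -
      have "t * v = s * (v - u)"
        using that(1) by (simp add: algebra_simps)
      then have "x / (s * u) = x * (v - u) / (t * u * v)"
        using that by (simp add: divide_simps)
      also have "\<dots> = x / (t * u) - x / (t * v)"
        using that(2-) by (simp add: divide_simps algebra_simps)
      finally show ?thesis .
    qed
    from this[OF rel] show ?thesis
      using km pos by (simp del: of_nat_Suc)
  qed
  \<comment> \<open>Both terms lie in column \<open>k\<close>, in rows \<open>m\<close> and
    \<open>n\<close>, so the induction hypothesis is needed for two different rows.\<close>
  also have "\<dots> \<in> \<int>"
    unfolding a_def c_def
    using step.prems km n by (intro Ints_diff step.IH) auto
  finally show ?case .
qed

lemma rat_of_nat_divide_in_Ints_iff:
  fixes a b :: nat
  assumes "b > 0"
  shows "(of_nat a / of_nat b :: rat) \<in> \<int> \<longleftrightarrow> b dvd a"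
proof
  assume "(of_nat a / of_nat b :: rat) \<in> \<int>"
  then obtain i :: int where "(of_nat a / of_nat b :: rat) = of_int i"
    by (auto elim: Ints_cases)
  then have "(of_int (int a) :: rat) = of_int (int b * i)"
    using assms by (simp add: field_simps)
  then have "int a = int b * i"
    by (simp only: of_int_eq_iff)
  then show "b dvd a"
    by (metis dvd_triv_left int_dvd_int_iff)
qed (use assms in auto)

lemma binomial_dvd_Lcm:
  assumes "k \<le> n"
  shows "(n choose k) dvd Lcm {1..n}"
proof (cases "k = 0")
  case False
  then have "(of_nat (Lcm {1..n}) :: rat) / of_nat (k * (n choose k)) \<in> \<int>"
    using assms by (intro leibniz_triangle_Ints) auto
  then have "k * (n choose k) dvd Lcm {1..n}"
    using False assms by (subst (asm) rat_of_nat_divide_in_Ints_iff) auto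
  then show ?thesis
    by (rule dvd_mult_right)
qed auto

text \<open>The multiplicity of \<open>p\<close> in an lcm of nonzero numbers is the maximum of the
  multiplicities, hence attained by some element. The condition \<open>e > 0\<close> excludes the
  empty set, whose \<open>Lcm\<close> is 1.\<close>

lemma prime_power_dvd_Lcm:
  fixes p :: nat
  assumes "finite A" "0 \<notin> A" "prime p" "p ^ e dvd Lcm A" "e > 0"
  shows "\<exists>a\<in>A. p ^ e dvd a"
  using assms(1,2,4)
proof (induction A)
  case empty
  then show ?case
    using assms(3,5) by (simp add: prime_nat_iff)
next
  case (insert x A)
  have nz: "x \<noteq> 0" "Lcm A \<noteq> 0"
    using insert by (auto simp: Lcm_0_iff)
  then have "multiplicity p (lcm x (Lcm A)) = max (multiplicity p x) (multiplicity p (Lcm A))"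
    using assms(3) by (rule multiplicity_lcm)
  moreover have "e \<le> multiplicity p (lcm x (Lcm A))"
    using insert.prems nz assms(3) by (intro multiplicity_geI) (auto simp: lcm_eq_0_iff)
  ultimately have "p ^ e dvd x \<or> p ^ e dvd Lcm A"
    by (auto simp: le_max_iff_disj intro: multiplicity_dvd')
  then show ?case
    using insert by auto
qed

lemma prime_power_dvd_binomial_le:
  fixes p :: nat
  assumes "prime p" "p ^ e dvd (n choose k)" "k \<le> n" "n > 0"
  shows "p ^ e \<le> n"
proof (cases "e = 0")
  case False
  have "p ^ e dvd Lcm {1..n}"
    using assms(2) binomial_dvd_Lcm[OF assms(3)] by (rule dvd_trans)
  then obtain a where "a \<in> {1..n}" "p ^ e dvd a"
    using prime_power_dvd_Lcm[of "{1..n}" p e] assms False by auto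
  then show ?thesis
    by (auto dest: dvd_imp_le)
qed (use assms in auto)

text \<open>Otherwise \<open>n\<close> is at least 4, and Pascal's rule splits the coefficient into
  two entries of row \<open>n - 1\<close>, each at least \<open>n - 1\<close>. The total
  \<open>2 * (n - 1)\<close> exceeds the bound \<open>n\<close> on prime powers.\<close>

lemma binomial_prime_power_cases:
  assumes "prime p" "(n choose k) = p ^ e" "0 < k" "k < n"
  shows "k = 1 \<or> k = n - 1"
proof (rule ccontr)
  assume *: "\<not> ?thesis"
  have "n choose k = (n - 1 choose (k - 1)) + (n - 1 choose k)"
    using assms by (simp add: choose_reduce_nat)
  moreover have "n - 1 \<le> (n - 1 choose (k - 1))" "n - 1 \<le> (n - 1 choose k)"
    using * assms by (auto intro!: upper_le_binomial)
  moreover have "n choose k \<le> n"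
    using prime_power_dvd_binomial_le[of p e n k] assms by simp
  ultimately show False
    using * assms by linarith
qed

section \<open>Partial row sums of binomial coefficients\<close>

lemma sum_binomial_add_complement:
  "(\<Sum>k=0..n. (n + r) choose k) + (\<Sum>k=0..r. (n + r) choose k) = 2 ^ (n + r) + ((n + r) choose n)"
proof -
  \<comment> \<open>Reflection turns the second sum into the upper end of the row; together the two
    sums cover the row, counting only the term at \<open>n\<close> twice.\<close>
  have "(\<Sum>k=0..r. (n + r) choose k) = (\<Sum>k=n..n + r. (n + r) choose k)"
    by (rule sum.reindex_bij_witness[of _ "\<lambda>k. n + r - k" "\<lambda>k. n + r - k"])
      (auto simp: binomial_symmetric[symmetric])
  also have "\<dots> = ((n + r) choose n) + (\<Sum>k=Suc n..n + r. (n + r) choose k)"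
    by (simp add: sum.atLeast_Suc_atMost)
  finally show ?thesis
    using choose_row_sum[of "n + r"] sum.ub_add_nat[of 0 n "\<lambda>k. (n + r) choose k" r]
    by (simp add: atLeast0AtMost)
qed

lemma binomial_not_dvd_both_partial_sums:
  assumes "n \<ge> 1" "r \<ge> 1"
    and "((n + r) choose n) dvd (\<Sum>k=0..n. (n + r) choose k)"
    and "((n + r) choose n) dvd (\<Sum>k=0..r. (n + r) choose k)"
  shows False
proof -
  have "((n + r) choose n) dvd 2 ^ (n + r)"
    using dvd_add[OF assms(3,4)] unfolding sum_binomial_add_complement by simp
  then obtain e where "(n + r) choose n = 2 ^ e"
    using divides_primepow_nat[OF two_is_prime_nat] by blast
  then have "n = 1 \<or> r = 1"
    using binomial_prime_power_cases[OF two_is_prime_nat, of "n + r" n e] assms(1,2) by auto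
  \<comment> \<open>When one parameter is 1 and the other is \<open>m\<close>, the binomial
    coefficient is \<open>Suc m\<close>, and the partial sum up to 1 is
    \<open>Suc (Suc m)\<close>.\<close>
  moreover have "\<not> Suc m dvd Suc (Suc m)" if "m \<ge> 1" for m
    using that dvd_add_right_iff[of "Suc m" "Suc m" 1] by simp
  ultimately show False
    using assms by auto
qed

section \<open>The polynomials and their values at -1\<close>

lemma coeff_S_poly:
  "coeff (S_poly r n) k = (if k \<le> n then inverse (of_nat ((r + n) choose r)) *
     (of_nat ((r + n) choose k) * (-1) ^ (n - k)) else 0)"
proof -
  have "coeff (S_poly r n) k =
      (\<Sum>j=0..n. if n - j = k then of_nat (n choose j) * (-1) ^ j * inverse (of_nat ((r + j) choose r)) else 0)"
    by (simp add: S_poly_def coeff_sum)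
  also have "\<dots> = (\<Sum>j=0..n. if j = k then of_nat (n choose j) * (-1) ^ (n - j) *
      inverse (of_nat ((r + (n - j)) choose r)) else 0)"
    by (rule sum.reindex_bij_witness[of _ "\<lambda>j. n - j" "\<lambda>j. n - j"])
      (auto simp: binomial_symmetric[symmetric])
  also have "\<dots> = (if k \<le> n then of_nat (n choose k) * (-1) ^ (n - k) *
      inverse (of_nat ((r + (n - k)) choose r)) else 0)"
    by simp
  also have "\<dots> = (if k \<le> n then inverse (of_nat ((r + n) choose r)) *
     (of_nat ((r + n) choose k) * (-1) ^ (n - k)) else 0)"
  proof (cases "k \<le> n")
    case True
    \<comment> \<open>Trinomial revision trades the reciprocal depending on \<open>k\<close> for the
      constant \<open>(r + n) choose r\<close>.\<close>
    have "((r + n) choose (r + (n - k))) * ((r + (n - k)) choose r) = ((r + n) choose r) * (n choose (n - k))"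
      using True by (subst choose_mult) auto
    also have "(r + n) choose (r + (n - k)) = (r + n) choose k"
      using True by (subst binomial_symmetric) auto
    also have "n choose (n - k) = n choose k"
      using True by (rule binomial_symmetric[symmetric])
    finally have "(of_nat ((r + n) choose k) * of_nat ((r + (n - k)) choose r) :: rat) =
        of_nat ((r + n) choose r) * of_nat (n choose k)"
      by (metis of_nat_mult)
    then show ?thesis
      using True by (simp add: field_simps)
  qed simp
  finally show ?thesis .
qed

lemma S_poly_eq:
  "S_poly r n = smult (inverse (of_nat ((r + n) choose r)))
     (\<Sum>k=0..n. monom (of_nat ((r + n) choose k) * (-1) ^ (n - k)) k)"
  by (rule poly_eqI) (simp add: coeff_S_poly coeff_sum)

lemma poly_S_poly_minus_one:
  "poly (S_poly r n) (-1) =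
     (-1) ^ n * inverse (of_nat ((r + n) choose r)) * (\<Sum>k=0..n. of_nat ((r + n) choose k))"
proof -
  have sign: "(-1) ^ (n - k) * (-1) ^ k = ((-1) ^ n :: rat)" if "k \<le> n" for k
    using that by (simp flip: power_add)
  have "poly (S_poly r n) (-1) = inverse (of_nat ((r + n) choose r)) *
      (\<Sum>k=0..n. of_nat ((r + n) choose k) * ((-1) ^ (n - k) * (-1) ^ k))"
    unfolding S_poly_eq by (simp add: poly_sum poly_monom mult.assoc)
  also have "(\<Sum>k=0..n. of_nat ((r + n) choose k) * ((-1) ^ (n - k) * (-1) ^ k)) =
      (-1) ^ n * (\<Sum>k=0..n. of_nat ((r + n) choose k) :: rat)"
    unfolding sum_distrib_left by (rule sum.cong) (simp_all add: sign)
  finally show ?thesis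
    by (simp add: mult_ac)
qed

text \<open>The sign is a unit, so only the quotient of the partial sum by the binomial coefficient
  matters.\<close>

lemma poly_S_poly_in_Ints_iff:
  "poly (S_poly r n) (-1) \<in> \<int> \<longleftrightarrow> ((n + r) choose n) dvd (\<Sum>k=0..n. (n + r) choose k)"
proof -
  have C: "(r + n) choose r = (n + r) choose n"
    using binomial_symmetric[of n "n + r"] by (simp add: add.commute)
  have "poly (S_poly r n) (-1) =
      (-1) ^ n * (of_nat (\<Sum>k=0..n. (n + r) choose k) / of_nat ((n + r) choose n))"
    unfolding poly_S_poly_minus_one C by (simp add: divide_inverse mult_ac add.commute)
  moreover have "(-1) ^ n * x \<in> \<int> \<longleftrightarrow> x \<in> \<int>" for x :: rat
    by (cases "even n") auto
  ultimately show ?thesis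
    by (simp only: rat_of_nat_divide_in_Ints_iff zero_less_binomial le_add1)
qed

lemma S_poly_not_both_Ints:
  assumes "n \<ge> 1" "r \<ge> 1"
  shows "poly (S_poly r n) (-1) \<notin> \<int> \<or> poly (S_poly n r) (-1) \<notin> \<int>"
proof -
  have "(r + n) choose r = (n + r) choose n"
    using binomial_symmetric[of n "n + r"] by (simp add: add.commute)
  then show ?thesis
    using binomial_not_dvd_both_partial_sums[OF assms]
    by (auto simp: poly_S_poly_in_Ints_iff add.commute)
qed

lemma S_poly_consecutive_Ints_iff:
  "poly (S_poly (n + 1) n) (-1) \<in> \<int> \<longleftrightarrow> poly (S_poly n (n + 1)) (-1) \<in> \<int>"
proof -
  have "(n + 1 + n) choose (n + 1) = (n + (n + 1)) choose n"
    using binomial_symmetric[of n "n + (n + 1)"] by (simp add: add.commute)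
  \<comment> \<open>The only extra term, at \<open>n + 1\<close>, equals the divisor by symmetry of
    row \<open>2 * n + 1\<close>.\<close>
  moreover from this have "(\<Sum>k=0..n + 1. (n + 1 + n) choose k) =
      (\<Sum>k=0..n. (n + (n + 1)) choose k) + ((n + (n + 1)) choose n)"
    by (simp add: add.commute)
  ultimately show ?thesis
    unfolding poly_S_poly_in_Ints_iff by (simp only: dvd_add_left_iff dvd_refl)
qed

theorem theorem2p3:
  fixes n r :: nat
  assumes "n \<ge> 1" and "r \<ge> 1"
  shows "S_poly r n = smult (inverse (of_nat ((r + n) choose r)))
           (\<Sum>k=0..n. monom (of_nat ((r + n) choose k) * (-1) ^ (n - k)) k)
    \<and> poly (S_poly r n) (-1) =
           (-1) ^ n * inverse (of_nat ((r + n) choose r)) * (\<Sum>k=0..n. of_nat ((r + n) choose k))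
    \<and> (-1) ^ n * poly (S_poly r n) (-1) + (-1) ^ r * poly (S_poly n r) (-1) =
           2 ^ (r + n) * inverse (of_nat ((r + n) choose r)) + 1
    \<and> (poly (S_poly r n) (-1) \<notin> \<int> \<or> poly (S_poly n r) (-1) \<notin> \<int>)
    \<and> poly (S_poly n n) (-1) \<notin> \<int>
    \<and> poly (S_poly (n + 1) n) (-1) \<notin> \<int>
    \<and> poly (S_poly n (n + 1)) (-1) \<notin> \<int>"
proof -
  define C :: rat where "C = of_nat ((r + n) choose r)"
  have C: "of_nat ((n + r) choose n) = C" and "C \<noteq> 0"
    using binomial_symmetric[of n "n + r"] by (simp_all add: C_def add.commute)
  have sign: "(-1) ^ m * ((-1) ^ m * a * b) = a * b" for m and a b :: rat
    by (cases "even m") auto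
  have "of_nat ((\<Sum>k=0..n. (n + r) choose k) + (\<Sum>k=0..r. (n + r) choose k)) = 2 ^ (n + r) + C"
    unfolding sum_binomial_add_complement by (simp add: C)
  then have total: "(\<Sum>k=0..n. of_nat ((r + n) choose k)) + (\<Sum>k=0..r. of_nat ((n + r) choose k)) =
      2 ^ (r + n) + C"
    by (simp add: add.commute)
  have "(-1) ^ n * poly (S_poly r n) (-1) + (-1) ^ r * poly (S_poly n r) (-1) =
      inverse C * ((\<Sum>k=0..n. of_nat ((r + n) choose k)) + (\<Sum>k=0..r. of_nat ((n + r) choose k)))"
    unfolding poly_S_poly_minus_one sign C by (simp add: C_def distrib_left)
  also have "\<dots> = 2 ^ (r + n) * inverse C + 1"
    unfolding total using \<open>C \<noteq> 0\<close> by (simp add: field_simps)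
  finally have "(-1) ^ n * poly (S_poly r n) (-1) + (-1) ^ r * poly (S_poly n r) (-1) =
      2 ^ (r + n) * inverse (of_nat ((r + n) choose r)) + 1"
    unfolding C_def .
  moreover have "poly (S_poly (n + 1) n) (-1) \<notin> \<int>" "poly (S_poly n (n + 1)) (-1) \<notin> \<int>"
    using S_poly_not_both_Ints[of n "n + 1"] S_poly_consecutive_Ints_iff[of n] assms by auto
  \<comment> \<open>For the parameters \<open>n\<close> and \<open>n\<close>, the two alternatives
    of \<open>S_poly_not_both_Ints\<close> coincide.\<close>
  ultimately show ?thesis
    using S_poly_eq poly_S_poly_minus_one S_poly_not_both_Ints[OF assms] S_poly_not_both_Ints[of n n] assms
    by blast
qed

end
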